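(* Let $\mu$ be a probability measure on $[0,1]$, absolutely continuous with continuous density $f_\mu$ that is non-increasing on $[0,1]$, and let $q\in(0,1)$. Then the percentile mechanism $\mathcal{PM}_{p}$ with percentile $p=\frac q2$ is optimal.
   Context: Single-facility setting: $n$ agents at $\vec x=(x_1,\dots,x_n)\in[0,1]^n$; a facility at $y$ with capacity $q$ accommodates the $\lfloor qn\rfloor$ agents closest to $y$ (ties arbitrary); an accommodated agent $i$ gets utility $1-|x_i-y|$, others $0$; the normalized social welfare is $SW(\vec x,y)=\frac1n\sum_i u_i$. For $p\in[0,1]$, $\mathcal{PM}_p$ places the facility at the $(\lfloor p(n-1)\rfloor+1)$-th smallest of $x_1,\dots,x_n$. The radius function $R_{\mu,q}(y)$ is the smallest $r\ge0$ with $\mu([y-r,y+r])=q$, and $\mathcal{W}(y)=\int_{[y-R_{\mu,q}(y),y+R_{\mu,q}(y)]}|x-y|\,d\mu(x)$. With $X_1,\dots,X_n$ i.i.d. of law $\mu$, $\mathcal{PM}_p$ is optimal if $\lim_{n\to\infty}\mathbb{E}[SW(\vec X,\mathcal{PM}_p(\vec X))]$ exists and equals $\max_{y\in[0,1]}(q-\mathcal{W}(y))$. *)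

theory Defs
  imports "HOL-Probability.Probability"
begin

text \<open>Normalized social welfare of a profile xs (length n) with a facility at y of
capacity q: the floor(q n) agents closest to y are accommodated (ties are irrelevant
for the sum), each getting utility 1 - |x_i - y|; others get 0.\<close>
definition SW :: "real \<Rightarrow> real list \<Rightarrow> real \<Rightarrow> real" where
  "SW q xs y =
     (let n = length xs; k = nat \<lfloor>q * real n\<rfloor>;
          ds = sort (map (\<lambda>x. \<bar>x - y\<bar>) xs)
      in (\<Sum>j<k. 1 - ds ! j) / real n)"

definition PM :: "real \<Rightarrow> real list \<Rightarrow> real" where
  "PM p xs = sort xs ! nat \<lfloor>p * (real (length xs) - 1)\<rfloor>"

definition radius :: "real measure \<Rightarrow> real \<Rightarrow> real \<Rightarrow> real" where
  "radius \<mu> q y = Inf {r. 0 \<le> r \<and> measure \<mu> {y - r..y + r} = q}"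

definition Wcost :: "real measure \<Rightarrow> real \<Rightarrow> real \<Rightarrow> real" where
  "Wcost \<mu> q y = (LINT x:{y - radius \<mu> q y..y + radius \<mu> q y}|\<mu>. \<bar>x - y\<bar>)"

definition expected_SW_PM :: "real measure \<Rightarrow> real \<Rightarrow> real \<Rightarrow> nat \<Rightarrow> real" where
  "expected_SW_PM \<mu> q p n =
     (\<integral>X. SW q (map X [0..<n]) (PM p (map X [0..<n])) \<partial>(PiM {..<n} (\<lambda>_. \<mu>)))"

definition PM_optimal :: "real measure \<Rightarrow> real \<Rightarrow> real \<Rightarrow> bool" where
  "PM_optimal \<mu> q p \<longleftrightarrow>
     (\<exists>L. expected_SW_PM \<mu> q p \<longlonglongrightarrow> L \<and>
          (\<exists>y\<in>{0..1}. L = q - Wcost \<mu> q y) \<and>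
          (\<forall>y\<in>{0..1}. q - Wcost \<mu> q y \<le> L))"

end

theory Submission
  imports Defs "HOL-Real_Asymp.Real_Asymp"
begin

text \<open>
  Let \<open>F\<close> be the distribution function, \<open>Q\<close> its quantile function and \<open>K s\<close> the integral of \<open>x\<close> over the
  lowest mass \<open>s\<close>, so that \<open>K' = Q\<close>. If a facility at \<open>y\<close> serves an interval whose left end is at
  level \<open>s\<close>, comparing \<open>y\<close> with the median of that interval gives
  \<open>W(y) \<ge> K (s + q) - 2 K (s + q/2) + K s\<close>. Since the density is non-increasing, \<open>F\<close> is concave on the
  positive half-line and \<open>Q\<close> is convex, so the right-hand side is non-decreasing in \<open>s\<close>. Its value at
  \<open>s = 0\<close> is attained at \<open>y = Q (q/2)\<close>, because the interval served from there is \<open>[0, Q q]\<close>, of which \<open>y\<close>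
  is the median.

  For the limit, let \<open>r\<close> be the radius at \<open>y\<close>. The sum of the \<open>\<lfloor>q n\<rfloor>\<close> smallest distances is, up to the number of
  misplaced agents, a sum of the capped distances \<open>min \<bar>x - y\<bar> r\<close> minus a constant. This yields a
  deterministic bound on the deviation of the welfare by the uniform deviation of the empirical
  distribution function and the deviation of one empirical mean; both tend to \<open>0\<close> in expectation by
  the variance bound, the first one after restriction to a finite grid.
\<close>

section \<open>Order statistics\<close>

text \<open>A downward closed predicate holds on an initial segment of a sorted list. Applied to
  \<open>\<le> t\<close> and \<open>< t\<close>, this turns bounds on order statistics into
  counts.\<close>

lemma sorted_nth_iff_less_length_filter:
  assumes "sorted xs" "j < length xs" "\<And>x y. x \<le> y \<Longrightarrow> P y \<Longrightarrow> P x"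
  shows "P (xs ! j) \<longleftrightarrow> j < length (filter P xs)"
  using assms(1,2)
proof (induction xs arbitrary: j)
  case (Cons x xs)
  show ?case
  proof (cases "P x")
    case True
    then show ?thesis
      using Cons by (cases j) auto
  next
    case False
    then have "\<not> P y" if "y \<in> set (x # xs)" for y
      using Cons.prems that assms(3) by auto
    then show ?thesis
      using nth_mem[OF Cons.prems(2)] by (auto simp: filter_empty_conv)
  qed
qed simp

lemma sort_nth_iff_less_length_filter:
  assumes "j < length xs" "\<And>x y. x \<le> y \<Longrightarrow> P y \<Longrightarrow> P x"
  shows "P (sort xs ! j) \<longleftrightarrow> j < length (filter P xs)"
proof -
  have "length (filter P (sort xs)) = length (filter P xs)"
    by (simp add: filter_sort)
  then show ?thesis
    using sorted_nth_iff_less_length_filter[of "sort xs" j P] assms by simp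
qed

lemma real_length_filter: "real (length (filter P xs)) = (\<Sum>x\<leftarrow>xs. indicator {x. P x} x)"
  by (induction xs) (auto simp: indicator_def)

definition empirical_mean :: "('a \<Rightarrow> real) \<Rightarrow> 'a list \<Rightarrow> real" where
  "empirical_mean h xs = (\<Sum>x\<leftarrow>xs. h x) / real (length xs)"

abbreviation ecdf :: "real list \<Rightarrow> real \<Rightarrow> real" where
  "ecdf xs t \<equiv> empirical_mean (indicator {..t}) xs"

lemma ecdf_eq: "ecdf xs t = real (length (filter (\<lambda>x. x \<le> t) xs)) / real (length xs)"
  by (simp add: empirical_mean_def real_length_filter atMost_def)

lemma ecdf_mono: "s \<le> t \<Longrightarrow> ecdf xs s \<le> ecdf xs t"
  unfolding empirical_mean_def by (intro divide_right_mono sum_list_mono) (auto split: split_indicator)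

lemma empirical_mean_diff_le:
  assumes "\<And>x. x \<in> set xs \<Longrightarrow> \<bar>h x - h' x\<bar> \<le> c" "0 \<le> c"
  shows "\<bar>empirical_mean h xs - empirical_mean h' xs\<bar> \<le> c"
proof (cases "xs = []")
  case False
  have "\<bar>(\<Sum>x\<leftarrow>xs. h x) - (\<Sum>x\<leftarrow>xs. h' x)\<bar> = \<bar>\<Sum>x\<leftarrow>xs. h x - h' x\<bar>"
    by (simp add: sum_list_subtractf)
  also have "\<dots> \<le> (\<Sum>x\<leftarrow>xs. \<bar>h x - h' x\<bar>)"
    using sum_list_abs[of "map (\<lambda>x. h x - h' x) xs"] by (simp add: o_def)
  also have "\<dots> \<le> (\<Sum>x\<leftarrow>xs. c)"
    by (intro sum_list_mono assms)
  finally show ?thesis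
    using False by (simp add: empirical_mean_def sum_list_triv field_simps flip: diff_divide_distrib)
qed (use assms in \<open>simp add: empirical_mean_def\<close>)

section \<open>Welfare in terms of capped distances\<close>

text \<open>Capping keeps the \<open>N\<close> distances up to \<open>r\<close> and replaces the
  others by \<open>r\<close>; the second sum keeps the first \<open>k\<close> instead. They differ
  only at positions between \<open>k\<close> and \<open>N\<close>, each time by at most 1, since
  distances and \<open>r\<close> lie in the unit interval.\<close>

lemma sorted_partial_sum_approx:
  fixes ds :: "real list"
  assumes "sorted ds" "k \<le> length ds" "set ds \<subseteq> {0..1}" "0 \<le> r" "r \<le> 1"
  shows "\<bar>(\<Sum>d\<leftarrow>ds. min d r) - ((\<Sum>j<k. ds ! j) + real (length ds - k) * r)\<bar>
    \<le> \<bar>real (length (filter (\<lambda>d. d \<le> r) ds)) - real k\<bar>"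
proof -
  define N n where "N = length (filter (\<lambda>d. d \<le> r) ds)" and "n = length ds"
  have N: "ds ! j \<le> r \<longleftrightarrow> j < N" if "j < n" for j
    using sorted_nth_iff_less_length_filter[of ds j "\<lambda>d. d \<le> r"] assms(1) that
    by (auto simp: N_def n_def)
  have "N \<le> n" by (simp add: N_def n_def)
  define T where "T j = (if j < k then ds ! j else r)" for j
  have *: "\<bar>min (ds ! j) r - T j\<bar> \<le> indicator {min k N..<max k N} j" if "j < n" for j
  proof -
    have "ds ! j \<in> {0..1}"
      using that assms(3) nth_mem[of j ds] unfolding n_def by blast
    then show ?thesis
      using N[OF that] assms(4,5) by (cases "j < k"; cases "j < N") (auto simp: T_def indicator_def)
  qed
  have "{..<n} = {..<k} \<union> {k..<n}" "{..<k} \<inter> {k..<n} = {}"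
    using assms(2) by (auto simp: n_def)
  then have "sum T {..<n} = sum T {..<k} + sum T {k..<n}"
    using sum.union_disjoint[of "{..<k}" "{k..<n}" T] by simp
  also have "\<dots> = (\<Sum>j<k. ds ! j) + real (n - k) * r"
    by (simp add: T_def)
  finally have "(\<Sum>d\<leftarrow>ds. min d r) - ((\<Sum>j<k. ds ! j) + real (n - k) * r) = (\<Sum>j<n. min (ds ! j) r) - sum T {..<n}"
    by (simp add: sum_list_sum_nth n_def atLeast0LessThan)
  also have "\<dots> = (\<Sum>j<n. min (ds ! j) r - T j)"
    by (simp add: sum_subtractf)
  also have "\<bar>\<dots>\<bar> \<le> (\<Sum>j<n. indicator {min k N..<max k N} j)"
    by (intro order_trans[OF sum_abs] sum_mono *) auto
  also have "\<dots> = real (card ({..<n} \<inter> {min k N..<max k N}))"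
    by (simp add: indicator_def sum.inter_restrict[symmetric] flip: of_bool_def)
      (auto intro!: arg_cong[where f = card])
  also have "\<dots> \<le> real (card {min k N..<max k N})"
    by (intro of_nat_mono card_mono) auto
  also have "\<dots> = \<bar>real N - real k\<bar>"
    by (cases k N rule: le_cases) auto
  finally show ?thesis
    by (simp add: N_def n_def)
qed

lemma capacity_le:
  assumes "0 \<le> q" "q \<le> 1"
  shows "nat \<lfloor>q * real n\<rfloor> \<le> n"
proof -
  have "real (nat \<lfloor>q * real n\<rfloor>) \<le> q * real n"
    using assms by simp
  also have "\<dots> \<le> 1 * real n"
    using assms by (intro mult_right_mono) auto
  finally show ?thesis by simp
qed

lemma percentile_index_less:
  assumes "0 \<le> p" "p \<le> 1" "0 < n"
  shows "nat \<lfloor>p * (real n - 1)\<rfloor> < n"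
proof -
  have "nat \<lfloor>p * real (n - 1)\<rfloor> \<le> n - 1"
    using assms by (intro capacity_le) auto
  then show ?thesis
    using assms by (simp add: of_nat_diff)
qed

text \<open>The radius \<open>r\<close> is free, so it can later be the one belonging to the limit
  location and not to \<open>y\<close>. The constant 3 arises because \<open>q * n\<close> replaces
  its floor \<open>k\<close> in three places: the number of served agents, the total of the capped
  distances, and the count compared with \<open>N\<close>.\<close>

lemma SW_approx:
  assumes "xs \<noteq> []" "\<And>x. x \<in> set xs \<Longrightarrow> \<bar>x - y\<bar> \<le> 1" "0 \<le> q" "q \<le> 1" "0 \<le> r" "r \<le> 1"
  shows "\<bar>SW q xs y - (q - empirical_mean (\<lambda>x. min \<bar>x - y\<bar> r) xs + (1 - q) * r)\<bar>
    \<le> \<bar>real (length (filter (\<lambda>x. \<bar>x - y\<bar> \<le> r) xs)) / real (length xs) - q\<bar> + 3 / real (length xs)"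
proof -
  define n k where "n = length xs" and "k = nat \<lfloor>q * real n\<rfloor>"
  define ds where "ds = sort (map (\<lambda>x. \<bar>x - y\<bar>) xs)"
  define N where "N = real (length (filter (\<lambda>x. \<bar>x - y\<bar> \<le> r) xs))"
  define M where "M = (\<Sum>x\<leftarrow>xs. min \<bar>x - y\<bar> r)"
  define S where "S = (\<Sum>j<k. ds ! j)"
  have n: "0 < n" using assms(1) by (simp add: n_def)
  have k: "real k \<le> q * n" "q * n < real k + 1"
    using assms(3) by (auto simp: k_def)
  have "k \<le> n"
    unfolding k_def by (rule capacity_le) (use assms in auto)
  have "mset (map (\<lambda>d. min d r) ds) = mset (map (\<lambda>x. min \<bar>x - y\<bar> r) xs)"
    by (simp add: ds_def image_mset.compositionality o_def)
  then have M: "M = (\<Sum>d\<leftarrow>ds. min d r)"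
    unfolding M_def by (metis sum_mset_sum_list)
  have "length (filter (\<lambda>d. d \<le> r) ds) = length (filter (\<lambda>x. \<bar>x - y\<bar> \<le> r) xs)"
    unfolding ds_def filter_sort length_sort by (simp add: filter_map o_def)
  moreover have "set ds \<subseteq> {0..1}"
    using assms(2) by (auto simp: ds_def)
  ultimately have *: "\<bar>M - (S + (real n - real k) * r)\<bar> \<le> \<bar>N - real k\<bar>"
    using sorted_partial_sum_approx[of ds k r] assms \<open>k \<le> n\<close>
    by (simp add: M S_def N_def ds_def n_def of_nat_diff)
  have "\<bar>real k * r - q * n * r\<bar> \<le> 1"
  proof -
    have "\<bar>real k * r - q * n * r\<bar> = \<bar>real k - q * n\<bar> * r"
      using assms(5) by (simp add: abs_mult flip: left_diff_distrib)
    also have "\<dots> \<le> 1 * 1"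
      using k assms by (intro mult_mono) auto
    finally show ?thesis by simp
  qed
  moreover have "(real k - S) - (q * n - M + (1 - q) * r * n)
      = (real k - q * n) + (M - (S + (real n - real k) * r)) - (real k * r - q * n * r)"
    by (simp add: algebra_simps)
  ultimately have "\<bar>(real k - S) - (q * n - M + (1 - q) * r * n)\<bar> \<le> \<bar>N - q * n\<bar> + 3"
    using * k by linarith
  then have "\<bar>(real k - S) - (q * n - M + (1 - q) * r * n)\<bar> / n \<le> (\<bar>N - q * n\<bar> + 3) / n"
    by (intro divide_right_mono) auto
  moreover have "((real k - S) - (q * n - M + (1 - q) * r * n)) / n = (real k - S) / n - (q - M / n + (1 - q) * r)"
    using n by (simp add: diff_divide_distrib add_divide_distrib)
  then have "\<bar>(real k - S) - (q * n - M + (1 - q) * r * n)\<bar> / n = \<bar>(real k - S) / n - (q - M / n + (1 - q) * r)\<bar>"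
    by (metis abs_divide abs_of_nat)
  moreover have "(N - q * n) / n = N / n - q"
    using n by (simp add: diff_divide_distrib)
  then have "\<bar>N - q * n\<bar> / n = \<bar>N / n - q\<bar>"
    by (metis abs_divide abs_of_nat)
  moreover have "SW q xs y = (real k - S) / n"
    by (simp add: SW_def Let_def S_def ds_def k_def n_def sum_subtractf)
  ultimately show ?thesis
    by (simp add: empirical_mean_def M_def N_def n_def add_divide_distrib)
qed

section \<open>Location chosen by the percentile mechanism\<close>

text \<open>With \<open>m\<close> the zero-based index of the chosen agent, at least
  \<open>m + 1\<close> agents lie weakly to its left and at most \<open>m\<close> strictly. Separate
  counts are kept because the profile may have ties; the loss of \<open>1 / n\<close> comes from
  \<open>m + 1 > p * (n - 1) \<ge> p * n - 1\<close>.\<close>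

lemma
  assumes "xs \<noteq> []" "0 \<le> p" "p \<le> 1"
  shows PM_in_set: "PM p xs \<in> set xs"
    and ecdf_PM_ge: "p - 1 / real (length xs) \<le> ecdf xs (PM p xs)"
    and ecdf_less_PM_le: "real (length (filter (\<lambda>x. x < PM p xs) xs)) / real (length xs) \<le> p"
proof -
  define n m where "n = length xs" and "m = nat \<lfloor>p * (real n - 1)\<rfloor>"
  have n: "1 \<le> real n" using assms(1) by (cases xs) (auto simp: n_def)
  have m: "real m \<le> p * (real n - 1)" "p * (real n - 1) < real m + 1"
    using assms n by (auto simp: m_def)
  have "m < length xs"
    unfolding m_def n_def by (rule percentile_index_less) (use assms in auto)
  have PM: "PM p xs = sort xs ! m"
    by (simp add: PM_def m_def n_def)
  with \<open>m < length xs\<close> show "PM p xs \<in> set xs"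
    using nth_mem[of m "sort xs"] by simp
  have "m < length (filter (\<lambda>x. x \<le> PM p xs) xs)"
    using sort_nth_iff_less_length_filter[of m xs "\<lambda>x. x \<le> PM p xs"] \<open>m < length xs\<close> by (simp add: PM)
  then have "real m + 1 \<le> real (length (filter (\<lambda>x. x \<le> PM p xs) xs))"
    by linarith
  with m assms have "p * n - 1 \<le> real (length (filter (\<lambda>x. x \<le> PM p xs) xs))"
    by (simp add: algebra_simps)
  then have "(p * n - 1) / n \<le> real (length (filter (\<lambda>x. x \<le> PM p xs) xs)) / n"
    by (intro divide_right_mono) auto
  then show "p - 1 / real (length xs) \<le> ecdf xs (PM p xs)"
    using assms(1) by (simp add: ecdf_eq n_def diff_divide_distrib)
  have "\<not> m < length (filter (\<lambda>x. x < PM p xs) xs)"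
    using sort_nth_iff_less_length_filter[of m xs "\<lambda>x. x < PM p xs"] \<open>m < length xs\<close> by (simp add: PM)
  then have "real (length (filter (\<lambda>x. x < PM p xs) xs)) \<le> real m"
    by linarith
  also have "\<dots> \<le> p * n"
    using m assms by (simp add: algebra_simps)
  finally show "real (length (filter (\<lambda>x. x < PM p xs) xs)) / real (length xs) \<le> p"
    using assms(1) by (simp add: n_def pos_divide_le_eq)
qed

section \<open>Measurability of order statistics and welfare\<close>

text \<open>The entry at index \<open>j\<close> is at most \<open>t\<close> exactly when more than
  \<open>j\<close> of the values are, a condition on a finite sum of indicators.\<close>

lemma borel_measurable_sort_nth:
  fixes f :: "nat \<Rightarrow> 'a \<Rightarrow> real"
  assumes [measurable]: "\<And>i. i < n \<Longrightarrow> f i \<in> borel_measurable M" and "j < n"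
  shows "(\<lambda>x. sort (map (\<lambda>i. f i x) [0..<n]) ! j) \<in> borel_measurable M"
proof (subst borel_measurable_iff_le, intro allI)
  fix t
  have "sort (map (\<lambda>i. f i x) [0..<n]) ! j \<le> t \<longleftrightarrow> real j < (\<Sum>i<n. indicator {..t} (f i x))" for x
  proof -
    let ?c = "length (filter (\<lambda>y. y \<le> t) (map (\<lambda>i. f i x) [0..<n]))"
    have "real ?c = (\<Sum>i<n. indicator {..t} (f i x))"
      unfolding real_length_filter
      by (simp add: o_def interv_sum_list_conv_sum_set_nat atLeast0LessThan atMost_def)
    moreover have "sort (map (\<lambda>i. f i x) [0..<n]) ! j \<le> t \<longleftrightarrow> j < ?c"
      using assms(2) by (intro sort_nth_iff_less_length_filter) auto
    ultimately show ?thesis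
      by (metis of_nat_less_iff)
  qed
  then show "{x \<in> space M. sort (map (\<lambda>i. f i x) [0..<n]) ! j \<le> t} \<in> sets M"
    by simp
qed

lemma borel_measurable_SW_PM:
  assumes "sets \<mu> = sets borel" "0 < n" "0 \<le> p" "p \<le> 1" "0 \<le> q" "q \<le> 1"
  shows "(\<lambda>X. SW q (map X [0..<n]) (PM p (map X [0..<n]))) \<in> borel_measurable (PiM {..<n} (\<lambda>_. \<mu>))"
proof -
  let ?M = "PiM {..<n} (\<lambda>_. \<mu>)"
  have X: "(\<lambda>X. X i) \<in> borel_measurable ?M" if "i < n" for i
    using measurable_component_singleton[of i "{..<n}" "\<lambda>_. \<mu>"] that measurable_cong_sets[OF refl assms(1)] by blast
  have PM [measurable]: "(\<lambda>X. PM p (map X [0..<n])) \<in> borel_measurable ?M"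
    unfolding PM_def using borel_measurable_sort_nth[of n "\<lambda>i X. X i", OF X percentile_index_less] assms by simp
  have "(\<lambda>X. sort (map (\<lambda>i. \<bar>X i - PM p (map X [0..<n])\<bar>) [0..<n]) ! j) \<in> borel_measurable ?M"
    if "j < nat \<lfloor>q * real n\<rfloor>" for j
    using that capacity_le[of q n] assms by (intro borel_measurable_sort_nth borel_measurable_abs borel_measurable_diff X PM) auto
  then show ?thesis
    unfolding SW_def Let_def
    by (auto simp: o_def intro!: borel_measurable_divide borel_measurable_sum borel_measurable_diff)
qed

section \<open>Empirical means\<close>

lemma empirical_mean_map: "empirical_mean h (map X [0..<n]) = (\<Sum>i<n. h (X i)) / real n"
  by (simp add: empirical_mean_def o_def interv_sum_list_conv_sum_set_nat atLeast0LessThan)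

text \<open>Padding with factors 1 makes the integrand a product over all coordinates, whose
  integral factorizes; the factor at \<open>i\<close> integrates to 0.\<close>

lemma (in prob_space) integral_PiM_mult_eq_0:
  fixes z :: "'a \<Rightarrow> real"
  assumes "integrable M z" "(\<integral>x. z x \<partial>M) = 0" "finite I" "i \<in> I" "j \<in> I" "i \<noteq> j"
  shows "(\<integral>X. z (X i) * z (X j) \<partial>(PiM I (\<lambda>_. M))) = 0"
proof -
  interpret P: product_sigma_finite "\<lambda>_. M"
    by unfold_locales
  define f where "f k x = (if k \<in> {i, j} then z x else 1)" for k x
  have prod_f: "(\<Prod>k\<in>I. f k (X k)) = z (X i) * z (X j)" for X
  proof -
    have "(\<Prod>k\<in>I. f k (X k)) = (\<Prod>k\<in>I \<inter> {i, j}. z (X k))"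
      unfolding f_def using assms(3) by (rule prod.inter_restrict[symmetric])
    also have "I \<inter> {i, j} = {i, j}"
      using assms by auto
    finally show ?thesis
      using assms by simp
  qed
  have "(\<integral>X. (\<Prod>k\<in>I. f k (X k)) \<partial>(PiM I (\<lambda>_. M))) = (\<Prod>k\<in>I. \<integral>x. f k x \<partial>M)"
  proof (intro P.product_integral_prod assms(3))
    show "integrable M (f k)" for k
      using assms(1) unfolding f_def by (cases "k \<in> {i, j}") auto
  qed
  also have "(\<Prod>k\<in>I. \<integral>x. f k x \<partial>M) = 0"
    using assms by (intro prod_zero bexI[of _ i]) (auto simp: f_def)
  finally show ?thesis
    by (simp add: prod_f)
qed

text \<open>Uncorrelated centred terms bounded by 1 give a second moment of at most
  \<open>1 / n\<close>. A quadratic inequality then passes to the first moment.\<close>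

lemma (in prob_space) expectation_empirical_mean_deviation:
  fixes h :: "'a \<Rightarrow> real"
  assumes [measurable]: "h \<in> borel_measurable M" and h: "\<And>x. h x \<in> {0..1}" and n: "0 < n"
  defines "Z \<equiv> \<lambda>X. empirical_mean h (map X [0..<n]) - (\<integral>x. h x \<partial>M)"
  shows "integrable (PiM {..<n} (\<lambda>_. M)) (\<lambda>X. \<bar>Z X\<bar>)"
    and "(\<integral>X. \<bar>Z X\<bar> \<partial>(PiM {..<n} (\<lambda>_. M))) \<le> 1 / sqrt n"
proof -
  let ?P = "PiM {..<n} (\<lambda>_. M)"
  interpret P: prob_space ?P
    by (intro prob_space_PiM prob_space_axioms)
  define m z where "m = (\<integral>x. h x \<partial>M)" and "z x = h x - m" for x
  have hint: "integrable M h"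
    using h by (intro integrable_const_bound[where B = 1]) auto
  have "0 \<le> m"
    unfolding m_def using h by (intro integral_nonneg_AE) auto
  moreover have "m \<le> (\<integral>x. 1 \<partial>M)"
    unfolding m_def using h hint by (intro integral_mono) auto
  ultimately have z_le: "\<bar>z x\<bar> \<le> 1" for x
    using h[of x] by (auto simp: z_def prob_space)
  have z_meas [measurable]: "z \<in> borel_measurable M"
    unfolding z_def by measurable
  have z_comp [measurable]: "(\<lambda>X. z (X i)) \<in> borel_measurable ?P" if "i \<in> {..<n}" for i
    using that by measurable
  have z_int: "integrable M z" "(\<integral>x. z x \<partial>M) = 0"
    unfolding z_def using hint by (auto simp: m_def prob_space)
  have zz_le: "\<bar>z x * z y\<bar> \<le> 1" for x y
    using mult_mono[OF z_le[of x] z_le[of y]] by (simp add: abs_mult)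
  have zz_int: "integrable ?P (\<lambda>X. z (X i) * z (X j))" if "i \<in> {..<n}" "j \<in> {..<n}" for i j
    using that zz_le by (intro P.integrable_const_bound[where B = 1]) (auto intro!: borel_measurable_times)
  have Z: "Z X = (\<Sum>i<n. z (X i)) / n" for X
    using n by (simp add: Z_def empirical_mean_map z_def m_def sum_subtractf diff_divide_distrib)
  have [measurable]: "Z \<in> borel_measurable ?P"
    unfolding Z[abs_def] by (intro borel_measurable_divide borel_measurable_sum z_comp) auto
  have Z_le: "\<bar>Z X\<bar> \<le> 1" for X
  proof -
    have "\<bar>\<Sum>i<n. z (X i)\<bar> \<le> (\<Sum>i<n. 1)"
      by (intro order_trans[OF sum_abs] sum_mono z_le)
    then show ?thesis
      using n by (simp add: Z)
  qed
  show int_abs: "integrable ?P (\<lambda>X. \<bar>Z X\<bar>)"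
    using Z_le by (intro P.integrable_const_bound[where B = 1]) auto
  have Z2_int: "integrable ?P (\<lambda>X. (Z X)\<^sup>2)"
    using Z_le by (intro P.integrable_const_bound[where B = 1]) (auto simp: abs_square_le_1)
  have "(\<integral>X. (\<Sum>i<n. z (X i))\<^sup>2 \<partial>?P) = (\<integral>X. (\<Sum>i<n. \<Sum>j<n. z (X i) * z (X j)) \<partial>?P)"
    by (simp add: power2_eq_square sum_product)
  also have "\<dots> = (\<Sum>i<n. \<Sum>j<n. \<integral>X. z (X i) * z (X j) \<partial>?P)"
    using zz_int by (subst Bochner_Integration.integral_sum)
      (auto intro!: sum.cong Bochner_Integration.integral_sum Bochner_Integration.integrable_sum)
  also have "\<dots> \<le> (\<Sum>i<n. \<Sum>j<n. of_bool (i = j))"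
  proof (intro sum_mono)
    fix i j assume ij: "i \<in> {..<n}" "j \<in> {..<n}"
    have "(\<integral>X. z (X i) * z (X j) \<partial>?P) \<le> (\<integral>X. 1 \<partial>?P)"
      using zz_int[OF ij] zz_le by (intro integral_mono) (auto intro: order_trans[OF abs_ge_self])
    then show "(\<integral>X. z (X i) * z (X j) \<partial>?P) \<le> of_bool (i = j)"
      using integral_PiM_mult_eq_0[OF z_int _ ij] by (cases "i = j") (auto simp: P.prob_space)
  qed
  also have "\<dots> = n"
    by simp
  finally have "(\<integral>X. (Z X)\<^sup>2 \<partial>?P) \<le> 1 / n"
    using n by (simp add: Z power_divide divide_le_eq power2_eq_square field_simps)
  then have "sqrt n * (\<integral>X. (Z X)\<^sup>2 \<partial>?P) \<le> sqrt n * (1 / n)"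
    by (intro mult_left_mono) auto
  also have "sqrt n * (1 / n) = 1 / sqrt n"
    using sqrt_divide_self_eq[of "real n"] by (simp add: field_simps)
  finally have bound: "sqrt n * (\<integral>X. (Z X)\<^sup>2 \<partial>?P) \<le> 1 / sqrt n" .
  have "(\<integral>X. \<bar>Z X\<bar> \<partial>?P) \<le> (\<integral>X. (sqrt n * (Z X)\<^sup>2 + 1 / sqrt n) / 2 \<partial>?P)"
  proof (intro integral_mono int_abs)
    fix X
    \<comment> \<open>The weight \<open>sqrt n\<close> balances the two terms of the expanded
      square: both have expectation at most \<open>1 / sqrt n\<close>.\<close>
    have "0 \<le> (sqrt n * \<bar>Z X\<bar> - 1)\<^sup>2 / sqrt n"
      by simp
    also have "\<dots> = sqrt n * (Z X)\<^sup>2 + 1 / sqrt n - 2 * \<bar>Z X\<bar>"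
      using n by (simp add: power2_eq_square field_simps)
    finally show "\<bar>Z X\<bar> \<le> (sqrt n * (Z X)\<^sup>2 + 1 / sqrt n) / 2"
      by simp
  qed (use Z2_int in auto)
  also have "\<dots> = (sqrt n * (\<integral>X. (Z X)\<^sup>2 \<partial>?P) + 1 / sqrt n) / 2"
    using Z2_int by (simp add: P.prob_space)
  also have "\<dots> \<le> (1 / sqrt n + 1 / sqrt n) / 2"
    by (intro divide_right_mono add_mono bound) auto
  finally show "(\<integral>X. \<bar>Z X\<bar> \<partial>?P) \<le> 1 / sqrt n"
    by simp
qed

section \<open>Optimal placement for a non-increasing density\<close>

text \<open>The density is extended by 0 outside the unit interval. It is thus non-increasing on the
  whole non-negative half-line, and estimates may run past 1.\<close>

locale antimono_density = real_distribution \<mu> for \<mu> :: "real measure" +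
  fixes g :: "real \<Rightarrow> real"
  assumes density: "\<mu> = density lborel (\<lambda>x. ennreal (g x))"
    and g_measurable [measurable]: "g \<in> borel_measurable borel"
    and g_nonneg: "0 \<le> g x"
    and g_support: "x \<notin> {0..1} \<Longrightarrow> g x = 0"
    and g_antimono: "0 \<le> x \<Longrightarrow> x \<le> y \<Longrightarrow> g y \<le> g x"
begin

section \<open>Distribution function of a non-increasing density\<close>

lemma AE_unit_interval: "AE x in \<mu>. x \<in> {0..1}"
proof -
  have "AE x in lborel. 0 < ennreal (g x) \<longrightarrow> x \<in> {0..1}"
    using g_support by (intro AE_I2) force
  then show ?thesis
    unfolding density by (subst AE_density) auto
qed

text \<open>On the interval the density is largest at the left end. Together with the lower bound
  \<open>cdf_diff_ge\<close>, this takes the place of differentiating the distribution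
  function.\<close>

lemma cdf_diff_le:
  assumes "0 \<le> u" "u \<le> v"
  shows "cdf \<mu> v - cdf \<mu> u \<le> g u * (v - u)"
proof (cases "u = v")
  case False
  have "emeasure \<mu> {u<..v} = (\<integral>\<^sup>+ x. ennreal (g x) * indicator {u<..v} x \<partial>lborel)"
    unfolding density by (subst emeasure_density) auto
  also have "\<dots> \<le> (\<integral>\<^sup>+ x. ennreal (g u) * indicator {u<..v} x \<partial>lborel)"
    using assms g_antimono[of u]
    by (intro nn_integral_mono) (auto split: split_indicator intro!: ennreal_leI)
  also have "\<dots> = ennreal (g u * (v - u))"
    using assms g_nonneg by (simp add: nn_integral_cmult_indicator ennreal_mult)
  finally have "measure \<mu> {u<..v} \<le> g u * (v - u)"
    using assms g_nonneg[of u] by (simp add: emeasure_eq_measure)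
  then show ?thesis
    using assms False by (subst cdf_diff_eq) auto
qed simp

lemma cdf_diff_ge:
  assumes "0 \<le> u" "u \<le> v"
  shows "g v * (v - u) \<le> cdf \<mu> v - cdf \<mu> u"
proof (cases "u = v")
  case False
  have "ennreal (g v * (v - u)) = (\<integral>\<^sup>+ x. ennreal (g v) * indicator {u<..v} x \<partial>lborel)"
    using assms g_nonneg by (simp add: nn_integral_cmult_indicator ennreal_mult)
  also have "\<dots> \<le> (\<integral>\<^sup>+ x. ennreal (g x) * indicator {u<..v} x \<partial>lborel)"
    using assms g_antimono[of _ v]
    by (intro nn_integral_mono) (auto split: split_indicator intro!: ennreal_leI)
  also have "\<dots> = emeasure \<mu> {u<..v}"
    unfolding density by (subst emeasure_density) auto
  finally have "g v * (v - u) \<le> measure \<mu> {u<..v}"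
    using assms g_nonneg[of v] by (simp add: emeasure_eq_measure)
  then show ?thesis
    using assms False by (subst cdf_diff_eq) auto
qed simp

lemma measure_singleton [simp]: "measure \<mu> {x} = 0"
proof -
  have "AE y in lborel. y \<noteq> x"
    by (rule AE_lborel_singleton)
  then have "AE y in \<mu>. y \<noteq> x"
    unfolding density by (subst AE_density) auto
  then have "AE y in \<mu>. y \<notin> {x}"
    by simp
  then show ?thesis
    by (subst prob_eq_0) auto
qed

lemma continuous_on_cdf_density: "continuous_on A (cdf \<mu>)"
  by (intro continuous_at_imp_continuous_on) (simp add: isCont_cdf)

lemma measure_Icc:
  assumes "u \<le> v"
  shows "measure \<mu> {u..v} = cdf \<mu> v - cdf \<mu> u"
proof (cases "u = v")
  case False
  have "{u..v} = {u} \<union> {u<..v}"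
    using assms by auto
  then have "measure \<mu> {u..v} = measure \<mu> {u} + measure \<mu> {u<..v}"
    by (simp only:) (subst finite_measure_Union, auto)
  then show ?thesis
    using assms False by (simp add: cdf_diff_eq)
qed simp

lemma cdf_eq_0:
  assumes "x \<le> 0"
  shows "cdf \<mu> x = 0"
proof -
  have "AE y in \<mu>. y \<noteq> 0"
    using prob_eq_0[of "{0}"] by simp
  with AE_unit_interval have "AE y in \<mu>. y \<notin> {..x}"
    by eventually_elim (use assms in auto)
  then show ?thesis
    unfolding cdf_def by (subst prob_eq_0) auto
qed

lemma cdf_eq_1:
  assumes "1 \<le> x"
  shows "cdf \<mu> x = 1"
proof -
  have "AE y in \<mu>. y \<in> {..x}"
    using AE_unit_interval by eventually_elim (use assms in auto)
  then show ?thesis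
    unfolding cdf_def by (subst prob_eq_1) auto
qed

text \<open>If the distribution function is flat up to \<open>v\<close>, then
  \<open>g v = 0\<close>; by monotonicity no mass lies beyond \<open>v\<close>, so the level is
  already 1.\<close>

lemma cdf_less:
  assumes "0 \<le> u" "u < v" "cdf \<mu> u < 1"
  shows "cdf \<mu> u < cdf \<mu> v"
proof (rule ccontr)
  assume "\<not> ?thesis"
  then have eq: "cdf \<mu> v = cdf \<mu> u"
    using cdf_nondecreasing[of u v] assms by simp
  with cdf_diff_ge[of u v] assms g_nonneg[of v] have "g v = 0"
    by (smt (verit, best) mult_pos_pos)
  with cdf_diff_le[of v "max v 1"] assms have "1 \<le> cdf \<mu> v"
    by (simp add: cdf_eq_1)
  with eq assms show False by simp
qed

lemma cdf_lipschitz: "\<bar>cdf \<mu> v - cdf \<mu> u\<bar> \<le> g 0 * \<bar>v - u\<bar>"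
proof -
  have *: "cdf \<mu> v - cdf \<mu> u \<le> g 0 * (v - u)" if "u \<le> v" for u v
  proof -
    have "cdf \<mu> v - cdf \<mu> u = cdf \<mu> (max 0 v) - cdf \<mu> (max 0 u)"
      by (simp add: max_def cdf_eq_0)
    also have "\<dots> \<le> g (max 0 u) * (max 0 v - max 0 u)"
      using that by (intro cdf_diff_le) auto
    also have "\<dots> \<le> g 0 * (v - u)"
      using that g_antimono[of 0 "max 0 u"] g_nonneg by (intro mult_mono) auto
    finally show ?thesis .
  qed
  show ?thesis
    using *[of u v] *[of v u] cdf_nondecreasing[of u v] cdf_nondecreasing[of v u]
    by (cases u v rule: le_cases) auto
qed

text \<open>The value of \<open>g\<close> at the midpoint separates the halves: times the
  half-length, it bounds the right mass from above and the left mass from below.\<close>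

lemma cdf_midpoint_concave:
  assumes "0 \<le> u" "u \<le> v"
  shows "(cdf \<mu> u + cdf \<mu> v) / 2 \<le> cdf \<mu> ((u + v) / 2)"
proof -
  let ?m = "(u + v) / 2"
  have "cdf \<mu> v - cdf \<mu> ?m \<le> g ?m * (v - ?m)"
    using assms by (intro cdf_diff_le) (auto simp: field_simps)
  also have "\<dots> = g ?m * (?m - u)"
    by (simp add: field_simps)
  also have "\<dots> \<le> cdf \<mu> ?m - cdf \<mu> u"
    using assms by (intro cdf_diff_ge) (auto simp: field_simps)
  finally show ?thesis by simp
qed

section \<open>Quantile function\<close>

text \<open>Levels below 1 are attained at one point of the unit interval, by
  \<open>cdf_less\<close>; level 1 may be attained on a whole interval. Hence the choice operator,
  and the restriction to levels below 1 in the order properties.\<close>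

definition quantile :: "real \<Rightarrow> real" where
  "quantile s = (SOME x. x \<in> {0..1} \<and> cdf \<mu> x = s)"

lemma
  assumes "0 \<le> s" "s \<le> 1"
  shows quantile_nonneg: "0 \<le> quantile s"
    and quantile_le_1: "quantile s \<le> 1"
    and cdf_quantile: "cdf \<mu> (quantile s) = s"
proof -
  have "\<exists>x. 0 \<le> x \<and> x \<le> 1 \<and> cdf \<mu> x = s"
    using assms
    by (intro IVT' continuous_on_cdf_density) (auto simp: cdf_eq_0 cdf_eq_1)
  then have "quantile s \<in> {0..1} \<and> cdf \<mu> (quantile s) = s"
    unfolding quantile_def by (intro someI_ex[of "\<lambda>x. x \<in> {0..1} \<and> cdf \<mu> x = s"]) auto
  then show "0 \<le> quantile s" "quantile s \<le> 1" "cdf \<mu> (quantile s) = s"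
    by auto
qed

lemma quantile_cdf:
  assumes "0 \<le> x" "cdf \<mu> x < 1"
  shows "quantile (cdf \<mu> x) = x"
proof -
  have "cdf \<mu> (quantile (cdf \<mu> x)) = cdf \<mu> x" "0 \<le> quantile (cdf \<mu> x)"
    using assms by (auto intro!: cdf_quantile quantile_nonneg simp: cdf_nonneg)
  then show ?thesis
    using cdf_less[of x "quantile (cdf \<mu> x)"] cdf_less[of "quantile (cdf \<mu> x)" x] assms
    by (cases x "quantile (cdf \<mu> x)" rule: linorder_cases) auto
qed

lemma quantile_mono:
  assumes "0 \<le> s" "s \<le> t" "t < 1"
  shows "quantile s \<le> quantile t"
proof (rule ccontr)
  assume "\<not> ?thesis"
  moreover have "cdf \<mu> (quantile s) = s" "cdf \<mu> (quantile t) = t" "0 \<le> quantile t"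
    using assms by (auto intro!: cdf_quantile quantile_nonneg)
  ultimately show False
    using cdf_less[of "quantile t" "quantile s"] assms by auto
qed

text \<open>A density vanishing there would vanish further right too, leaving no mass to raise the
  level from \<open>s\<close> to 1.\<close>

lemma g_quantile_pos:
  assumes "0 \<le> s" "s < 1"
  shows "0 < g (quantile s)"
proof -
  have "quantile s \<le> 1" "0 \<le> quantile s" "cdf \<mu> (quantile s) = s"
    using assms quantile_le_1 quantile_nonneg cdf_quantile by auto
  with cdf_diff_le[of "quantile s" 1] assms show ?thesis
    using g_nonneg[of "quantile s"] by (cases "g (quantile s) = 0") (auto simp: cdf_eq_1 less_le)
qed

text \<open>Up to level \<open>r\<close> the distribution function has slope at least
  \<open>g (quantile r)\<close>, so its inverse has slope at most the reciprocal.\<close>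

lemma quantile_lipschitz:
  assumes "s \<in> {0..r}" "t \<in> {0..r}" "r < 1"
  shows "g (quantile r) * \<bar>quantile t - quantile s\<bar> \<le> \<bar>t - s\<bar>"
proof -
  have *: "g (quantile r) * (quantile t - quantile s) \<le> t - s"
    if "0 \<le> s" "s \<le> t" "t \<le> r" for s t
  proof -
    have "quantile s \<le> quantile t" "quantile t \<le> quantile r"
      using that assms by (auto intro!: quantile_mono)
    then have "g (quantile r) * (quantile t - quantile s) \<le> g (quantile t) * (quantile t - quantile s)"
      using that assms quantile_nonneg[of t] by (intro mult_right_mono g_antimono) auto
    also have "\<dots> \<le> cdf \<mu> (quantile t) - cdf \<mu> (quantile s)"
      using that assms by (intro cdf_diff_ge quantile_mono quantile_nonneg) auto
    finally show ?thesis
      using that assms by (simp add: cdf_quantile)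
  qed
  show ?thesis
  proof (cases s t rule: le_cases)
    case le
    then have "quantile s \<le> quantile t"
      using assms by (intro quantile_mono) auto
    with *[of s t] le assms show ?thesis by auto
  next
    case ge
    then have "quantile t \<le> quantile s"
      using assms by (intro quantile_mono) auto
    with *[of t s] ge assms show ?thesis by (auto simp: abs_minus_commute)
  qed
qed

text \<open>The inverse of a strictly increasing concave function is convex.\<close>

lemma quantile_midpoint_convex:
  assumes "0 \<le> s" "s \<le> t" "t < 1"
  shows "quantile ((s + t) / 2) \<le> (quantile s + quantile t) / 2"
proof (rule ccontr)
  let ?m = "(quantile s + quantile t) / 2"
  assume *: "\<not> ?thesis"
  have "(s + t) / 2 \<le> cdf \<mu> ?m"
    using cdf_midpoint_concave[of "quantile s" "quantile t"] assms
    by (simp add: cdf_quantile quantile_nonneg quantile_mono)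
  moreover have "cdf \<mu> ?m \<le> cdf \<mu> (quantile ((s + t) / 2))"
    using * by (intro cdf_nondecreasing) auto
  moreover have "cdf \<mu> (quantile ((s + t) / 2)) = (s + t) / 2"
    using assms by (intro cdf_quantile) auto
  ultimately show False
    using cdf_less[of ?m "quantile ((s + t) / 2)"] * assms quantile_nonneg[of s] quantile_nonneg[of t]
    by auto
qed

section \<open>Partial means and the Lorenz curve\<close>

definition partial_mean :: "real \<Rightarrow> real" where
  "partial_mean t = (\<integral>x. x * indicator {..t} x \<partial>\<mu>)"

lemma integrable_bounded_unit:
  fixes h :: "real \<Rightarrow> real"
  assumes [measurable]: "h \<in> borel_measurable borel" and "\<And>x. x \<in> {0..1} \<Longrightarrow> \<bar>h x\<bar> \<le> B"
  shows "integrable \<mu> h"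
proof (rule integrable_const_bound[where B = B])
  show "AE x in \<mu>. norm (h x) \<le> B"
    using AE_unit_interval by eventually_elim (use assms in auto)
qed simp

lemma integrable_partial_mean: "integrable \<mu> (\<lambda>x. x * indicator {..t} x)"
  by (rule integrable_bounded_unit[where B = 1]) (auto split: split_indicator)

lemma partial_mean_diff:
  assumes "u \<le> v"
  shows "partial_mean v - partial_mean u = (\<integral>x. x * indicator {u<..v} x \<partial>\<mu>)"
proof -
  have "partial_mean v - partial_mean u = (\<integral>x. x * indicator {..v} x - x * indicator {..u} x \<partial>\<mu>)"
    unfolding partial_mean_def by (simp add: integrable_partial_mean)
  also have "\<dots> = (\<integral>x. x * indicator {u<..v} x \<partial>\<mu>)"
    using assms by (intro Bochner_Integration.integral_cong) (auto split: split_indicator)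
  finally show ?thesis .
qed

lemma integral_Ioc_const: "u \<le> v \<Longrightarrow> (\<integral>x. c * indicator {u<..v} x \<partial>\<mu>) = (c::real) * (cdf \<mu> v - cdf \<mu> u)"
  by (cases "u = v") (auto simp: cdf_diff_eq)

text \<open>The first two bounds compare \<open>x\<close> with the ends of the interval. The last
  two use that the mass sits in the unit interval, so the ends may lie anywhere.\<close>

lemma partial_mean_diff_bounds:
  assumes "u \<le> v"
  shows "u * (cdf \<mu> v - cdf \<mu> u) \<le> partial_mean v - partial_mean u"
    and "partial_mean v - partial_mean u \<le> v * (cdf \<mu> v - cdf \<mu> u)"
    and "0 \<le> partial_mean v - partial_mean u"
    and "partial_mean v - partial_mean u \<le> cdf \<mu> v - cdf \<mu> u"
proof -
  have i: "integrable \<mu> (\<lambda>x. c * indicator {u<..v} x)" for c :: real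
    by (rule integrable_bounded_unit[where B = "\<bar>c\<bar>"]) (auto split: split_indicator)
  have j: "integrable \<mu> (\<lambda>x. x * indicator {u<..v} x)"
    by (rule integrable_bounded_unit[where B = 1]) (auto split: split_indicator)
  show "u * (cdf \<mu> v - cdf \<mu> u) \<le> partial_mean v - partial_mean u"
    unfolding partial_mean_diff[OF assms] integral_Ioc_const[OF assms, symmetric]
    by (intro integral_mono i j) (auto split: split_indicator)
  show "partial_mean v - partial_mean u \<le> v * (cdf \<mu> v - cdf \<mu> u)"
    unfolding partial_mean_diff[OF assms] integral_Ioc_const[OF assms, symmetric]
    by (intro integral_mono i j) (auto split: split_indicator)
  have "AE x in \<mu>. 0 \<le> x * indicator {u<..v} x"
    using AE_unit_interval by eventually_elim auto
  then show "0 \<le> partial_mean v - partial_mean u"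
    unfolding partial_mean_diff[OF assms] by (rule integral_nonneg_AE)
  have "AE x in \<mu>. x * indicator {u<..v} x \<le> 1 * indicator {u<..v} x"
    using AE_unit_interval by eventually_elim (auto split: split_indicator)
  then show "partial_mean v - partial_mean u \<le> cdf \<mu> v - cdf \<mu> u"
    using integral_mono_AE[OF j i[of 1]] unfolding partial_mean_diff[OF assms] integral_Ioc_const[OF assms]
    by simp
qed

lemma partial_mean_cdf_lipschitz: "\<bar>partial_mean v - partial_mean u\<bar> \<le> \<bar>cdf \<mu> v - cdf \<mu> u\<bar>"
  using partial_mean_diff_bounds(3,4)[of u v] partial_mean_diff_bounds(3,4)[of v u]
  by (cases u v rule: le_cases) auto

text \<open>The generalized (unnormalized) Lorenz curve: the integral of \<open>x\<close> over the
  lowest mass \<open>s\<close>.\<close>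

definition lorenz :: "real \<Rightarrow> real" where
  "lorenz s = partial_mean (quantile s)"

text \<open>The point \<open>x\<close> and the quantile of its level carry no mass between them, so
  their partial means agree even when the points differ.\<close>

lemma partial_mean_eq_lorenz: "partial_mean x = lorenz (cdf \<mu> x)"
  using partial_mean_cdf_lipschitz[of x "quantile (cdf \<mu> x)"] cdf_quantile[of "cdf \<mu> x"]
  by (simp add: lorenz_def cdf_nonneg cdf_bounded_prob)

lemma lorenz_lipschitz:
  assumes "s \<in> {0..1}" "t \<in> {0..1}"
  shows "\<bar>lorenz t - lorenz s\<bar> \<le> \<bar>t - s\<bar>"
  using partial_mean_cdf_lipschitz[of "quantile t" "quantile s"] assms
  by (simp add: lorenz_def cdf_quantile)

lemma continuous_on_lorenz: "continuous_on {0..1} lorenz"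
proof -
  have "1-lipschitz_on {0..1} lorenz"
    using lorenz_lipschitz by (intro lipschitz_onI) (auto simp: dist_real_def)
  then show ?thesis
    by (rule lipschitz_on_continuous_on)
qed

text \<open>The increment integrates \<open>x\<close> over mass \<open>\<bar>t - s\<bar>\<close>
  lying between the two quantiles, where \<open>x\<close> differs from \<open>quantile s\<close> by
  at most their distance.\<close>

lemma lorenz_increment:
  assumes "s \<in> {0..<1}" "t \<in> {0..<1}"
  shows "\<bar>lorenz t - lorenz s - quantile s * (t - s)\<bar> \<le> \<bar>quantile t - quantile s\<bar> * \<bar>t - s\<bar>"
proof -
  have cdf: "cdf \<mu> (quantile s) = s" "cdf \<mu> (quantile t) = t"
    using assms by (auto intro!: cdf_quantile)
  show ?thesis
  proof (cases s t rule: le_cases)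
    case le
    then have "quantile s \<le> quantile t"
      using assms by (intro quantile_mono) auto
    with partial_mean_diff_bounds(1,2)[OF this] le show ?thesis
      by (simp add: lorenz_def cdf abs_of_nonneg abs_le_iff algebra_simps)
  next
    case ge
    then have "quantile t \<le> quantile s"
      using assms by (intro quantile_mono) auto
    with partial_mean_diff_bounds(1,2)[OF this] ge show ?thesis
      by (simp add: lorenz_def cdf abs_of_nonpos abs_le_iff algebra_simps)
  qed
qed

lemma DERIV_lorenz:
  assumes "0 < s" "s < 1"
  shows "(lorenz has_real_derivative quantile s) (at s)"
proof -
  \<comment> \<open>A level strictly between \<open>s\<close> and 1: up to it the quantile function
    is Lipschitz with a finite constant.\<close>
  define r where "r = (1 + s) / 2"
  define L where "L = g (quantile r)"
  have L: "0 < L"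
    unfolding L_def r_def using assms by (intro g_quantile_pos) auto
  have "\<forall>\<^sub>F t in at s. t \<in> {0<..<r}"
    using assms by (intro eventually_at_in_open') (auto simp: r_def)
  then have "\<forall>\<^sub>F t in at s. norm ((lorenz t - lorenz s) / (t - s) - quantile s) \<le> \<bar>t - s\<bar> / L"
    using eventually_neq_at_within[of s s UNIV]
  proof eventually_elim
    case (elim t)
    have "\<bar>(lorenz t - lorenz s) / (t - s) - quantile s\<bar> = \<bar>lorenz t - lorenz s - quantile s * (t - s)\<bar> / \<bar>t - s\<bar>"
      using elim by (simp add: field_simps flip: abs_divide)
    also have "\<dots> \<le> \<bar>quantile t - quantile s\<bar>"
      using elim assms lorenz_increment[of s t] by (simp add: r_def divide_le_eq)
    also have "\<dots> \<le> \<bar>t - s\<bar> / L"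
      using elim assms L quantile_lipschitz[of s r t]
      by (simp add: L_def r_def pos_le_divide_eq mult.commute)
    finally show ?case by simp
  qed
  moreover have "((\<lambda>t. \<bar>t - s\<bar> / L) \<longlongrightarrow> 0) (at s)"
    using L by (auto intro!: tendsto_eq_intros)
  ultimately have "((\<lambda>t. (lorenz t - lorenz s) / (t - s) - quantile s) \<longlongrightarrow> 0) (at s)"
    by (rule Lim_null_comparison)
  then show ?thesis
    unfolding has_field_derivative_iff by (rule Lim_null[THEN iffD2])
qed

text \<open>The derivative in \<open>s\<close> is a second difference of the quantile function,
  non-negative by convexity. Differentiability is used only at interior levels; continuity covers
  the end points.\<close>

lemma lorenz_second_difference_mono:
  assumes "0 < q" "q < 1" "0 \<le> s" "s \<le> 1 - q"
  shows "lorenz q - 2 * lorenz (q / 2) + lorenz 0 \<le> lorenz (s + q) - 2 * lorenz (s + q / 2) + lorenz s"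
proof -
  define H where "H s = lorenz (s + q) - 2 * lorenz (s + q / 2) + lorenz s" for s
  have "H 0 \<le> H s"
  proof (rule DERIV_nonneg_imp_increasing_open[OF assms(3)])
    fix t assume t: "0 < t" "t < s"
    have "(H has_real_derivative quantile (t + q) - 2 * quantile (t + q / 2) + quantile t) (at t)"
      unfolding H_def using t assms
      by (auto intro!: derivative_eq_intros DERIV_chain2[OF DERIV_lorenz, THEN DERIV_cong])
    moreover have "0 \<le> quantile (t + q) - 2 * quantile (t + q / 2) + quantile t"
      using quantile_midpoint_convex[of t "t + q"] t assms by (simp add: add_divide_distrib)
    ultimately show "\<exists>y. (H has_real_derivative y) (at t) \<and> 0 \<le> y"
      by blast
  next
    show "continuous_on {0..s} H"
      unfolding H_def using assms
      by (intro continuous_intros continuous_on_compose2[OF continuous_on_lorenz]) auto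
  qed
  then show ?thesis
    by (simp add: H_def)
qed

section \<open>Radius and cost of a facility\<close>

text \<open>The mass of the ball grows continuously from 0 at radius 0 to 1 at radius 1, so mass
  \<open>q\<close> is attained. The set of such radii is closed, so its infimum belongs to
  it.\<close>

lemma
  assumes "y \<in> {0..1}" "0 < q" "q < 1"
  shows radius_nonneg: "0 \<le> radius \<mu> q y"
    and radius_le_1: "radius \<mu> q y \<le> 1"
    and cdf_radius: "cdf \<mu> (y + radius \<mu> q y) = cdf \<mu> (y - radius \<mu> q y) + q"
proof -
  define G where "G r = cdf \<mu> (y + r) - cdf \<mu> (y - r)" for r
  define S where "S = {r. 0 \<le> r \<and> measure \<mu> {y - r..y + r} = q}"
  have S: "S = {0..} \<inter> G -` {q}"
    by (auto simp: S_def G_def measure_Icc)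
  have cont: "continuous_on A G" for A
    unfolding G_def
    by (intro continuous_intros continuous_on_compose2[OF continuous_on_cdf_density[of UNIV]]) auto
  have "\<exists>r. 0 \<le> r \<and> r \<le> 1 \<and> G r = q"
    using assms by (intro IVT' cont) (auto simp: G_def cdf_eq_0 cdf_eq_1)
  then obtain r where r: "r \<in> S" "r \<le> 1"
    by (auto simp: S)
  have "closed S"
    unfolding S using cont by (intro continuous_closed_preimage) auto
  moreover have bdd: "bdd_below S"
    by (rule bdd_belowI[of _ 0]) (auto simp: S)
  ultimately have "Inf S \<in> S"
    using r by (intro closed_contains_Inf) auto
  moreover have "Inf S \<le> 1"
    using r bdd by (meson cInf_lower order_trans)
  moreover have "radius \<mu> q y = Inf S"
    by (simp add: radius_def S_def)
  ultimately show "0 \<le> radius \<mu> q y" "radius \<mu> q y \<le> 1"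
      "cdf \<mu> (y + radius \<mu> q y) = cdf \<mu> (y - radius \<mu> q y) + q"
    by (auto simp: S G_def)
qed

text \<open>Integrating \<open>\<bar>x - y\<bar>\<close> against a median split point \<open>m\<close> of the catchment interval
  makes the terms in \<open>y\<close> cancel.\<close>

lemma integral_median_split:
  assumes "a \<le> m" "m \<le> c" "cdf \<mu> c - cdf \<mu> m = cdf \<mu> m - cdf \<mu> a"
  shows "(\<integral>x. (x - y) * indicator {m<..c} x + (y - x) * indicator {a<..m} x \<partial>\<mu>)
    = lorenz (cdf \<mu> c) - 2 * lorenz (cdf \<mu> m) + lorenz (cdf \<mu> a)"
proof -
  have i: "integrable \<mu> (\<lambda>x. x * indicator {u<..v} x)" for u v
    by (rule integrable_bounded_unit[where B = 1]) (auto split: split_indicator)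
  have j: "integrable \<mu> (\<lambda>x. y * indicator {u<..v} x)" for u v
    by (rule integrable_bounded_unit[where B = "\<bar>y\<bar>"]) (auto split: split_indicator)
  have "(\<integral>x. (x - y) * indicator {m<..c} x + (y - x) * indicator {a<..m} x \<partial>\<mu>)
    = (partial_mean c - partial_mean m - y * (cdf \<mu> c - cdf \<mu> m))
      + (y * (cdf \<mu> m - cdf \<mu> a) - (partial_mean m - partial_mean a))"
    using assms(1,2) i j
    by (simp add: left_diff_distrib partial_mean_diff integral_Ioc_const flip: integral_Ioc_const)
  then show ?thesis
    by (simp add: assms(3) partial_mean_eq_lorenz)
qed

text \<open>For every split point, \<open>\<bar>x - y\<bar>\<close> dominates \<open>x - y\<close>
  to its right and \<open>y - x\<close> to its left. Splitting at the median of the served interval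
  removes \<open>y\<close> from the bound.\<close>

lemma Wcost_ge:
  assumes "y \<in> {0..1}" "0 < q" "q < 1"
  shows "lorenz q - 2 * lorenz (q / 2) + lorenz 0 \<le> Wcost \<mu> q y"
proof -
  define a c s where "a = y - radius \<mu> q y" and "c = y + radius \<mu> q y" and "s = cdf \<mu> a"
  define m where "m = quantile (s + q / 2)"
  have c: "cdf \<mu> c = s + q"
    using cdf_radius[OF assms] by (simp add: a_def c_def s_def)
  then have s: "0 \<le> s" "s + q \<le> 1"
    using cdf_nonneg[of a] cdf_bounded_prob[of c] by (auto simp: s_def)
  then have m: "cdf \<mu> m = s + q / 2"
    unfolding m_def using assms by (intro cdf_quantile) auto
  have "\<not> m < a" "\<not> c < m"
    using m c assms(2) cdf_nondecreasing[of m a] cdf_nondecreasing[of c m] by (auto simp: s_def)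
  then have "a \<le> m" "m \<le> c"
    by auto
  then have "lorenz (s + q) - 2 * lorenz (s + q / 2) + lorenz s
      = (\<integral>x. (x - y) * indicator {m<..c} x + (y - x) * indicator {a<..m} x \<partial>\<mu>)"
    using integral_median_split[of a m c y] by (simp add: m c s_def)
  also have "\<dots> \<le> (\<integral>x. indicator {a..c} x * \<bar>x - y\<bar> \<partial>\<mu>)"
  proof (rule integral_mono)
    show "integrable \<mu> (\<lambda>x. (x - y) * indicator {m<..c} x + (y - x) * indicator {a<..m} x)"
      using assms by (intro integrable_bounded_unit[where B = 2]) (auto split: split_indicator)
    show "integrable \<mu> (\<lambda>x. indicator {a..c} x * \<bar>x - y\<bar>)"
      using assms by (intro integrable_bounded_unit[where B = 2]) (auto split: split_indicator)
  qed (use \<open>a \<le> m\<close> \<open>m \<le> c\<close> in \<open>auto split: split_indicator\<close>)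
  also have "\<dots> = Wcost \<mu> q y"
    by (simp add: Wcost_def set_lebesgue_integral_def a_def c_def)
  finally show ?thesis
    using lorenz_second_difference_mono[OF assms(2,3), of s] s by linarith
qed

text \<open>Here \<open>y\<close> is itself the median of its served interval, so splitting at
  \<open>y\<close> represents \<open>\<bar>x - y\<bar>\<close> exactly.\<close>

lemma Wcost_quantile_half:
  assumes "0 < q" "q < 1"
  defines "y \<equiv> quantile (q / 2)"
  shows "Wcost \<mu> q y = lorenz q - 2 * lorenz (q / 2) + lorenz 0"
proof -
  have y: "y \<in> {0..1}" "cdf \<mu> y = q / 2"
    unfolding y_def using assms quantile_nonneg quantile_le_1 cdf_quantile by auto
  define a c where "a = y - radius \<mu> q y" and "c = y + radius \<mu> q y"
  have c: "cdf \<mu> c = cdf \<mu> a + q" and "a \<le> y" "y \<le> c"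
    using cdf_radius[OF y(1)] radius_nonneg[OF y(1)] assms by (auto simp: a_def c_def)
  \<comment> \<open>If mass lay to the left of \<open>a\<close>, midpoint concavity on
    \<open>{a..c}\<close> would give \<open>y\<close> a level of at least
    \<open>cdf \<mu> a + q / 2\<close>, above \<open>q / 2\<close>.\<close>
  have a: "cdf \<mu> a = 0"
  proof (rule ccontr)
    assume "\<not> ?thesis"
    then have "0 < cdf \<mu> a"
      using cdf_nonneg[of a] by (simp add: a_def)
    moreover from this have "0 \<le> a"
      using cdf_eq_0[of a] by linarith
    moreover have "(a + c) / 2 = y"
      by (simp add: a_def c_def)
    ultimately show False
      using cdf_midpoint_concave[of a c] y c \<open>a \<le> y\<close> \<open>y \<le> c\<close> by auto
  qed
  have "AE x in \<mu>. x \<noteq> a"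
    using prob_eq_0[of "{a}"] by simp
  then have "AE x in \<mu>. indicator {a..c} x * \<bar>x - y\<bar> = (x - y) * indicator {y<..c} x + (y - x) * indicator {a<..y} x"
    by eventually_elim (use \<open>a \<le> y\<close> \<open>y \<le> c\<close> in \<open>auto split: split_indicator\<close>)
  then have "(\<integral>x. indicator {a..c} x * \<bar>x - y\<bar> \<partial>\<mu>) =
      (\<integral>x. (x - y) * indicator {y<..c} x + (y - x) * indicator {a<..y} x \<partial>\<mu>)"
    by (intro integral_cong_AE) auto
  then show "Wcost \<mu> q y = lorenz q - 2 * lorenz (q / 2) + lorenz 0"
    using integral_median_split[of a y c y] a c y \<open>a \<le> y\<close> \<open>y \<le> c\<close>
    by (simp add: Wcost_def set_lebesgue_integral_def a_def c_def)
qed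

section \<open>Convergence of the expected welfare\<close>

text \<open>Both functions are monotone, so a deviation inside a grid cell is controlled by those at
  its ends plus the increase \<open>g 0 / K\<close> of the distribution function. The sum, in place
  of a maximum, allows expectations to be taken term by term.\<close>

lemma ecdf_grid_bound:
  fixes K :: nat
  assumes "xs \<noteq> []" "set xs \<subseteq> {0..1}" "0 < K"
  shows "\<bar>ecdf xs t - cdf \<mu> t\<bar> \<le> (\<Sum>j\<le>K. \<bar>ecdf xs (j / K) - cdf \<mu> (j / K)\<bar>) + g 0 / K"
    (is "_ \<le> ?S + _")
proof -
  have S: "\<bar>ecdf xs (j / K) - cdf \<mu> (j / K)\<bar> \<le> ?S" if "j \<le> K" for j
    using that by (intro member_le_sum) auto
  then have "0 \<le> ?S" by (intro sum_nonneg) auto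
  have g0: "0 \<le> g 0 / K"
    using g_nonneg by simp
  consider "t < 0" | "1 \<le> t" | "0 \<le> t" "t < 1" by linarith
  then show ?thesis
  proof cases
    case 1
    then have "filter (\<lambda>x. x \<le> t) xs = []"
      using assms(2) by (force simp: filter_empty_conv)
    then show ?thesis
      using 1 \<open>0 \<le> ?S\<close> g0 by (simp add: ecdf_eq cdf_eq_0)
  next
    case 2
    then have "filter (\<lambda>x. x \<le> t) xs = xs"
      using assms(2) by (force simp: filter_id_conv)
    then show ?thesis
      using 2 assms(1) \<open>0 \<le> ?S\<close> g0 by (simp add: ecdf_eq cdf_eq_1)
  next
    case 3
    define j where "j = nat \<lfloor>t * K\<rfloor>"
    have j: "real j \<le> t * K" "t * K < real (Suc j)"
      using 3 real_of_int_floor_add_one_gt[of "t * K"] by (simp_all add: j_def add.commute)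
    have "t * K < 1 * real K"
      using 3 assms(3) by (intro mult_strict_right_mono) auto
    with j have "Suc j \<le> K" by simp
    let ?u = "real j / K" and ?v = "real (Suc j) / K"
    have uv: "?u \<le> t" "t \<le> ?v"
      using j assms(3) by (auto simp: field_simps)
    have "\<bar>cdf \<mu> ?v - cdf \<mu> ?u\<bar> \<le> g 0 * \<bar>?v - ?u\<bar>"
      by (rule cdf_lipschitz)
    also have "\<dots> = g 0 / K"
      by (simp add: add_divide_distrib)
    finally have "cdf \<mu> ?v - cdf \<mu> ?u \<le> g 0 / K" by simp
    moreover have "\<bar>ecdf xs ?u - cdf \<mu> ?u\<bar> \<le> ?S" "\<bar>ecdf xs ?v - cdf \<mu> ?v\<bar> \<le> ?S"
      using S[of j] S[of "Suc j"] \<open>Suc j \<le> K\<close> by auto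
    moreover have "ecdf xs ?u \<le> ecdf xs t" "ecdf xs t \<le> ecdf xs ?v" "cdf \<mu> ?u \<le> cdf \<mu> t" "cdf \<mu> t \<le> cdf \<mu> ?v"
      using uv by (auto intro: ecdf_mono cdf_nondecreasing)
    ultimately show ?thesis by linarith
  qed
qed

text \<open>The strict count at \<open>t\<close> is at least the weak count slightly to the left,
  and the Lipschitz bound makes the lost mass arbitrarily small.\<close>

lemma ecdf_less_ge:
  assumes "\<And>t. \<bar>ecdf xs t - cdf \<mu> t\<bar> \<le> D"
  shows "cdf \<mu> t - D \<le> real (length (filter (\<lambda>x. x < t) xs)) / real (length xs)"
proof (rule field_le_epsilon)
  fix e :: real assume e: "0 < e"
  define d where "d = e / (g 0 + 1)"
  have d: "0 < d" "g 0 * d \<le> e"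
    using e g_nonneg[of 0] by (auto simp: d_def field_simps)
  have "cdf \<mu> t - cdf \<mu> (t - d) \<le> e"
    using cdf_lipschitz[of t "t - d"] d by simp
  moreover have "cdf \<mu> (t - d) - D \<le> ecdf xs (t - d)"
    using assms[of "t - d"] by linarith
  moreover have "ecdf xs (t - d) \<le> real (length (filter (\<lambda>x. x < t) xs)) / real (length xs)"
    using d unfolding empirical_mean_def real_length_filter
    by (intro divide_right_mono sum_list_mono) (auto split: split_indicator)
  ultimately show "cdf \<mu> t - D \<le> real (length (filter (\<lambda>x. x < t) xs)) / real (length xs) + e"
    by linarith
qed

lemma cdf_PM_bound:
  assumes "xs \<noteq> []" "0 \<le> p" "p \<le> 1" "\<And>t. \<bar>ecdf xs t - cdf \<mu> t\<bar> \<le> D"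
  shows "\<bar>cdf \<mu> (PM p xs) - p\<bar> \<le> D + 1 / real (length xs)"
proof -
  have "cdf \<mu> (PM p xs) - D \<le> p"
    using ecdf_less_ge[OF assms(4), of "PM p xs"] ecdf_less_PM_le[OF assms(1-3)] by linarith
  moreover have "p - 1 / real (length xs) \<le> cdf \<mu> (PM p xs) + D"
    using ecdf_PM_ge[OF assms(1-3)] assms(4)[of "PM p xs"] by linarith
  moreover have "0 \<le> 1 / real (length xs)" by simp
  ultimately show ?thesis by linarith
qed

lemma ball_count_bound:
  assumes "xs \<noteq> []" "0 \<le> r" "\<And>t. \<bar>ecdf xs t - cdf \<mu> t\<bar> \<le> D"
  shows "\<bar>real (length (filter (\<lambda>x. \<bar>x - y\<bar> \<le> r) xs)) / real (length xs) - (cdf \<mu> (y + r) - cdf \<mu> (y - r))\<bar> \<le> 2 * D"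
proof -
  let ?L = "real (length (filter (\<lambda>x. x < y - r) xs)) / real (length xs)"
  have "real (length (filter (\<lambda>x. \<bar>x - y\<bar> \<le> r) xs)) + real (length (filter (\<lambda>x. x < y - r) xs))
      = real (length (filter (\<lambda>x. x \<le> y + r) xs))"
    using assms(2) by (induction xs) auto
  then have "real (length (filter (\<lambda>x. \<bar>x - y\<bar> \<le> r) xs)) / real (length xs) = ecdf xs (y + r) - ?L"
    by (simp add: ecdf_eq flip: diff_divide_distrib)
  moreover have "cdf \<mu> (y - r) - D \<le> ?L"
    using ecdf_less_ge[OF assms(3)] .
  moreover have "?L \<le> ecdf xs (y - r)"
    unfolding empirical_mean_def real_length_filter
    by (intro divide_right_mono sum_list_mono) (auto split: split_indicator)
  ultimately show ?thesis
    using assms(3)[of "y + r"] assms(3)[of "y - r"] by linarith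
qed

text \<open>Up to level \<open>q\<close> the quantile function is Lipschitz with constant
  \<open>1 / g (quantile q)\<close>. Above level \<open>q\<close> the level error exceeds
  \<open>q / 2\<close> while the distance is at most 1, so the factor \<open>2 / q\<close>
  suffices.\<close>

lemma dist_quantile_half_le:
  assumes "y \<in> {0..1}" "0 < q" "q < 1"
  shows "\<bar>y - quantile (q / 2)\<bar> \<le> (1 / g (quantile q) + 2 / q) * \<bar>cdf \<mu> y - q / 2\<bar>"
proof (cases "cdf \<mu> y \<le> q")
  case True
  have g: "0 < g (quantile q)"
    using assms by (intro g_quantile_pos) auto
  have "quantile (cdf \<mu> y) = y"
    using True assms by (intro quantile_cdf) auto
  then have "g (quantile q) * \<bar>y - quantile (q / 2)\<bar> \<le> \<bar>cdf \<mu> y - q / 2\<bar>"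
    using quantile_lipschitz[of "q / 2" q "cdf \<mu> y"] True assms cdf_nonneg[of y] by simp
  then have "\<bar>y - quantile (q / 2)\<bar> \<le> 1 / g (quantile q) * \<bar>cdf \<mu> y - q / 2\<bar>"
    using g by (simp add: pos_le_divide_eq mult.commute)
  also have "\<dots> \<le> (1 / g (quantile q) + 2 / q) * \<bar>cdf \<mu> y - q / 2\<bar>"
    using assms by (intro mult_right_mono) auto
  finally show ?thesis .
next
  case False
  have "\<bar>y - quantile (q / 2)\<bar> \<le> 1"
    using assms quantile_nonneg[of "q / 2"] quantile_le_1[of "q / 2"] by auto
  also have "1 = 2 / q * (q / 2)"
    using assms by simp
  also have "\<dots> \<le> (1 / g (quantile q) + 2 / q) * \<bar>cdf \<mu> y - q / 2\<bar>"
    using False assms g_nonneg[of "quantile q"] by (intro mult_mono) auto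
  finally show ?thesis .
qed

text \<open>Outside the served ball, of mass \<open>1 - q\<close>, the capped distance is
  \<open>r\<close>. The resulting term cancels the correction in \<open>SW_approx\<close>.\<close>

lemma integral_capped_distance:
  assumes "y \<in> {0..1}" "0 < q" "q < 1"
  defines "r \<equiv> radius \<mu> q y"
  shows "(\<integral>x. min \<bar>x - y\<bar> r \<partial>\<mu>) = Wcost \<mu> q y + (1 - q) * r"
proof -
  have r: "0 \<le> r" "measure \<mu> {y - r..y + r} = q"
    using radius_nonneg[OF assms(1-3)] cdf_radius[OF assms(1-3)] by (auto simp: r_def measure_Icc)
  have i: "integrable \<mu> (\<lambda>x. indicator {y - r..y + r} x * \<bar>x - y\<bar>)"
    using assms by (intro integrable_bounded_unit[where B = 1]) (auto split: split_indicator)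
  have j: "integrable \<mu> (\<lambda>x. r * indicator {y - r..y + r} x)"
    by (rule integrable_bounded_unit[where B = "\<bar>r\<bar>"]) (auto split: split_indicator)
  have "(\<integral>x. min \<bar>x - y\<bar> r \<partial>\<mu>)
      = (\<integral>x. indicator {y - r..y + r} x * \<bar>x - y\<bar> + (r - r * indicator {y - r..y + r} x) \<partial>\<mu>)"
    by (intro Bochner_Integration.integral_cong) (auto split: split_indicator)
  also have "\<dots> = Wcost \<mu> q y + (r - r * q)"
    using r(2) j prob_space by (subst Bochner_Integration.integral_add[OF i])
      (auto simp: Wcost_def set_lebesgue_integral_def r_def prob_space)
  finally show ?thesis
    by (simp add: algebra_simps)
qed

text \<open>The radius stays the one at the limit location \<open>y\<close>, so \<open>h\<close>
  does not depend on the sample and one empirical mean suffices. Replacing \<open>y\<close> by the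
  sampled location costs a multiple of their distance.\<close>

lemma SW_PM_deviation:
  assumes "0 < q" "q < 1"
  defines "y \<equiv> quantile (q / 2)"
  defines "h \<equiv> \<lambda>x. min \<bar>x - y\<bar> (radius \<mu> q y)"
  obtains A where "0 \<le> A"
    and "\<And>xs D. \<lbrakk>xs \<noteq> []; set xs \<subseteq> {0..1}; \<And>t. \<bar>ecdf xs t - cdf \<mu> t\<bar> \<le> D\<rbrakk> \<Longrightarrow>
      \<bar>SW q xs (PM (q / 2) xs) - (q - Wcost \<mu> q y)\<bar>
        \<le> A * (D + 1 / real (length xs)) + \<bar>empirical_mean h xs - (\<integral>x. h x \<partial>\<mu>)\<bar>"
proof -
  define r where "r = radius \<mu> q y"
  define C where "C = 1 / g (quantile q) + 2 / q"
  \<comment> \<open>The 3 absorbs \<open>2 * D\<close> and \<open>3 / n\<close>;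
    \<open>2 * g 0 * C\<close> pays for shifting both ends of the ball, and the last
    \<open>C\<close> for shifting the capped distances.\<close>
  define A where "A = 3 + (2 * g 0 + 1) * C"
  have y: "y \<in> {0..1}"
    unfolding y_def using assms quantile_nonneg quantile_le_1 by auto
  have r: "0 \<le> r" "r \<le> 1" "cdf \<mu> (y + r) - cdf \<mu> (y - r) = q"
    using radius_nonneg[OF y assms(1,2)] radius_le_1[OF y assms(1,2)] cdf_radius[OF y assms(1,2)]
    by (auto simp: r_def)
  have C: "0 \<le> C"
    unfolding C_def using assms g_nonneg by auto
  have "0 \<le> A"
    unfolding A_def using C g_nonneg[of 0] by auto
  moreover have "\<bar>SW q xs (PM (q / 2) xs) - (q - Wcost \<mu> q y)\<bar>
      \<le> A * (D + 1 / real (length xs)) + \<bar>empirical_mean h xs - (\<integral>x. h x \<partial>\<mu>)\<bar>"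
    if xs: "xs \<noteq> []" "set xs \<subseteq> {0..1}" and D: "\<And>t. \<bar>ecdf xs t - cdf \<mu> t\<bar> \<le> D" for xs D
  proof -
    define Y where "Y = PM (q / 2) xs"
    define e where "e = D + 1 / real (length xs)"
    define N where "N = real (length (filter (\<lambda>x. \<bar>x - Y\<bar> \<le> r) xs)) / real (length xs)"
    have Y: "Y \<in> {0..1}"
      unfolding Y_def using PM_in_set[OF xs(1), of "q / 2"] assms xs(2) by auto
    have "0 \<le> D"
      using D[of 0] by linarith
    have "\<bar>Y - y\<bar> \<le> C * \<bar>cdf \<mu> Y - q / 2\<bar>"
      using dist_quantile_half_le[OF Y assms(1,2)] by (simp add: y_def C_def)
    also have "\<dots> \<le> C * e"
      unfolding Y_def e_def using assms xs D by (intro mult_left_mono C cdf_PM_bound) auto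
    finally have dist: "\<bar>Y - y\<bar> \<le> C * e" .
    have "g 0 * \<bar>Y - y\<bar> \<le> g 0 * (C * e)"
      by (intro mult_left_mono dist g_nonneg)
    then have "\<bar>cdf \<mu> (Y + r) - cdf \<mu> (y + r)\<bar> \<le> g 0 * (C * e)" "\<bar>cdf \<mu> (Y - r) - cdf \<mu> (y - r)\<bar> \<le> g 0 * (C * e)"
      using cdf_lipschitz[of "Y + r" "y + r"] cdf_lipschitz[of "Y - r" "y - r"] by auto
    then have N: "\<bar>N - q\<bar> \<le> 2 * D + 2 * (g 0 * (C * e))"
      using ball_count_bound[OF xs(1) r(1) D, of Y] r(3) by (simp add: N_def)
    have "\<bar>empirical_mean (\<lambda>x. min \<bar>x - Y\<bar> r) xs - empirical_mean h xs\<bar> \<le> \<bar>Y - y\<bar>"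
      by (intro empirical_mean_diff_le) (auto simp: h_def r_def)
    moreover have "\<bar>SW q xs Y - (q - empirical_mean (\<lambda>x. min \<bar>x - Y\<bar> r) xs + (1 - q) * r)\<bar> \<le> \<bar>N - q\<bar> + 3 / real (length xs)"
      unfolding N_def
    proof (rule SW_approx)
      show "\<bar>x - Y\<bar> \<le> 1" if "x \<in> set xs" for x
        using that xs(2) Y by (auto simp: abs_le_iff)
    qed (use xs assms r in auto)
    moreover have "(\<integral>x. h x \<partial>\<mu>) = Wcost \<mu> q y + (1 - q) * r"
      using integral_capped_distance[OF y assms(1,2)] by (simp add: h_def r_def)
    ultimately have "\<bar>SW q xs Y - (q - Wcost \<mu> q y)\<bar>
        \<le> 2 * D + 2 * (g 0 * (C * e)) + 3 / real (length xs) + C * e + \<bar>empirical_mean h xs - (\<integral>x. h x \<partial>\<mu>)\<bar>"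
      using N dist by linarith
    moreover have "A * e = 3 * D + 3 / real (length xs) + 2 * (g 0 * (C * e)) + C * e"
      by (simp add: A_def e_def algebra_simps)
    ultimately show ?thesis
      using \<open>0 \<le> D\<close> by (simp add: Y_def e_def)
  qed
  ultimately show thesis
    by (rule that)
qed

section \<open>Passage to expectations and to the limit\<close>

text \<open>The deterministic bound is integrated with \<open>D\<close> the grid sum plus
  \<open>g 0 / K\<close>. Each of the \<open>K + 1\<close> grid deviations, and that of
  \<open>h\<close>, has expectation at most \<open>1 / sqrt n\<close>.\<close>

lemma expected_SW_PM_deviation:
  assumes "0 < q" "q < 1"
  defines "y \<equiv> quantile (q / 2)"
  obtains A where "0 \<le> A"
    and "\<And>n K. \<lbrakk>0 < n; 0 < K\<rbrakk> \<Longrightarrow> \<bar>expected_SW_PM \<mu> q (q / 2) n - (q - Wcost \<mu> q y)\<bar>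
      \<le> A * (real (Suc K) * (1 / sqrt (real n)) + g 0 / real K + 1 / real n) + 1 / sqrt (real n)"
proof -
  define h where "h x = min \<bar>x - y\<bar> (radius \<mu> q y)" for x
  obtain A where "0 \<le> A" and A: "\<And>xs D. \<lbrakk>xs \<noteq> []; set xs \<subseteq> {0..1}; \<And>t. \<bar>ecdf xs t - cdf \<mu> t\<bar> \<le> D\<rbrakk> \<Longrightarrow>
      \<bar>SW q xs (PM (q / 2) xs) - (q - Wcost \<mu> q y)\<bar>
        \<le> A * (D + 1 / real (length xs)) + \<bar>empirical_mean h xs - (\<integral>x. h x \<partial>\<mu>)\<bar>"
    using SW_PM_deviation[OF assms(1,2)] unfolding y_def h_def[abs_def] by blast
  have dev: "\<bar>expected_SW_PM \<mu> q (q / 2) n - (q - Wcost \<mu> q y)\<bar>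
      \<le> A * (real (Suc K) * (1 / sqrt (real n)) + g 0 / real K + 1 / real n) + 1 / sqrt (real n)"
    if n: "0 < n" and K: "0 < K" for n K
  proof -
    let ?P = "PiM {..<n} (\<lambda>_. \<mu>)"
    interpret P: prob_space ?P
      by (intro prob_space_PiM prob_space_axioms)
    have y: "y \<in> {0..1}"
      unfolding y_def using assms quantile_nonneg quantile_le_1 by auto
    have h: "h x \<in> {0..1}" "h \<in> borel_measurable \<mu>" for x
      using radius_nonneg[OF y assms(1,2)] radius_le_1[OF y assms(1,2)]
      by (auto simp: h_def[abs_def] measurable_cong_sets[OF events_eq_borel refl])
    define dev where "dev f X = \<bar>empirical_mean f (map X [0..<n]) - (\<integral>x. f x \<partial>\<mu>)\<bar>" for f X
    have int: "integrable ?P (dev f)" "(\<integral>X. dev f X \<partial>?P) \<le> 1 / sqrt n"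
      if "f \<in> borel_measurable \<mu>" "\<And>x. f x \<in> {0..1}" for f
      using expectation_empirical_mean_deviation[OF that n] unfolding dev_def by auto
    have ind: "indicator {..t} \<in> borel_measurable \<mu>" "\<And>x. indicator {..t} x \<in> {0..1::real}" for t
      by (auto split: split_indicator)
    define S where "S X = SW q (map X [0..<n]) (PM (q / 2) (map X [0..<n]))" for X
    define B where "B X = A * ((\<Sum>j\<le>K. dev (indicator {..j / K}) X) + g 0 / K + 1 / n) + dev h X" for X
    have B_int: "integrable ?P B"
      unfolding B_def using int(1)[OF ind] int(1)[OF h(2,1)] by auto
    have S_meas [measurable]: "S \<in> borel_measurable ?P"
      unfolding S_def using assms n by (intro borel_measurable_SW_PM) auto
    \<comment> \<open>The measure lives on the whole real line, so the sample lies in the unit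
      interval only almost surely, and the bound is an almost-everywhere one.\<close>
    have "AE X in ?P. \<forall>i\<in>{..<n}. X i \<in> {0..1}"
      using AE_unit_interval
      by (intro AE_finite_allI AE_PiM_component[where M = "\<lambda>_. \<mu>"]) (auto intro: prob_space_axioms)
    then have bound: "AE X in ?P. \<bar>S X - (q - Wcost \<mu> q y)\<bar> \<le> B X"
    proof eventually_elim
      case (elim X)
      let ?xs = "map X [0..<n]"
      have xs: "?xs \<noteq> []" "set ?xs \<subseteq> {0..1}"
        using n elim by auto
      have "\<bar>ecdf ?xs t - cdf \<mu> t\<bar> \<le> (\<Sum>j\<le>K. dev (indicator {..j / K}) X) + g 0 / K" for t
        using ecdf_grid_bound[OF xs K, of t] by (simp add: dev_def cdf_def)
      from A[OF xs this] show ?case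
        by (simp add: S_def B_def dev_def)
    qed
    have "\<bar>S X\<bar> \<le> B X + \<bar>q - Wcost \<mu> q y\<bar>" if "\<bar>S X - (q - Wcost \<mu> q y)\<bar> \<le> B X" for X
      using that by linarith
    then have S_int: "integrable ?P S"
      using bound B_int
      by (intro Bochner_Integration.integrable_bound[of ?P "\<lambda>X. B X + \<bar>q - Wcost \<mu> q y\<bar>" S])
        (auto elim!: eventually_mono intro: order_trans[OF _ abs_ge_self])
    have "\<bar>expected_SW_PM \<mu> q (q / 2) n - (q - Wcost \<mu> q y)\<bar> = \<bar>\<integral>X. S X - (q - Wcost \<mu> q y) \<partial>?P\<bar>"
      using S_int by (simp add: expected_SW_PM_def S_def[abs_def] P.prob_space)
    also have "\<dots> \<le> (\<integral>X. \<bar>S X - (q - Wcost \<mu> q y)\<bar> \<partial>?P)"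
      by (rule integral_abs_bound)
    also have "\<dots> \<le> (\<integral>X. B X \<partial>?P)"
      using S_int B_int bound by (intro integral_mono_AE) auto
    also have "\<dots> = A * ((\<Sum>j\<le>K. \<integral>X. dev (indicator {..j / K}) X \<partial>?P) + g 0 / K + 1 / n) + (\<integral>X. dev h X \<partial>?P)"
      unfolding B_def using int(1)[OF ind] int(1)[OF h(2,1)] by (simp add: P.prob_space)
    also have "\<dots> \<le> A * ((\<Sum>j\<le>K. 1 / sqrt n) + g 0 / K + 1 / n) + 1 / sqrt n"
      using \<open>0 \<le> A\<close> int(2)[OF ind] int(2)[OF h(2,1)]
      by (intro add_mono mult_left_mono sum_mono) auto
    finally show ?thesis
      by simp
  qed
  show thesis
    using \<open>0 \<le> A\<close> dev by (rule that)
qed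

lemma expected_SW_PM_tendsto:
  assumes "0 < q" "q < 1"
  shows "expected_SW_PM \<mu> q (q / 2) \<longlonglongrightarrow> q - Wcost \<mu> q (quantile (q / 2))" (is "_ \<longlonglongrightarrow> ?L")
proof (rule LIMSEQ_I)
  fix e :: real assume e: "0 < e"
  obtain A where A: "0 \<le> A" "\<And>n K. \<lbrakk>0 < n; 0 < K\<rbrakk> \<Longrightarrow> \<bar>expected_SW_PM \<mu> q (q / 2) n - ?L\<bar>
      \<le> A * (real (Suc K) * (1 / sqrt (real n)) + g 0 / real K + 1 / real n) + 1 / sqrt (real n)"
    using expected_SW_PM_deviation[OF assms] by blast
  \<comment> \<open>The grid is fixed first, making its error \<open>A * g 0 / K\<close> less than
    \<open>e / 2\<close>; then \<open>n\<close> tends to infinity and the remaining terms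
    vanish.\<close>
  obtain K :: nat where "2 * A * g 0 / e < real K"
    using reals_Archimedean2 by blast
  moreover have "0 \<le> 2 * A * g 0 / e"
    using A(1) e g_nonneg[of 0] by simp
  ultimately have "0 < real K" "2 * A * g 0 < real K * e"
    using e by (linarith, simp add: pos_divide_less_eq)
  then have K: "0 < K" "2 * A * g 0 < real K * e"
    by auto
  let ?B = "\<lambda>n. A * (real (Suc K) * (1 / sqrt (real n)) + g 0 / real K + 1 / real n) + 1 / sqrt (real n)"
  have "?B \<longlonglongrightarrow> A * (real (Suc K) * 0 + g 0 / real K + 0) + 0"
    by (intro tendsto_intros) real_asymp+
  moreover have "A * (real (Suc K) * 0 + g 0 / real K + 0) + 0 < e"
    using K e mult_nonneg_nonneg[OF A(1) g_nonneg[of 0]] by (simp add: field_simps)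
  ultimately have "\<forall>\<^sub>F n in sequentially. ?B n < e"
    by (rule order_tendstoD)
  then have "\<forall>\<^sub>F n in sequentially. norm (expected_SW_PM \<mu> q (q / 2) n - ?L) < e"
    using eventually_gt_at_top[of 0]
  proof eventually_elim
    case (elim n)
    then show ?case
      using A(2)[OF elim(2) K(1)] unfolding real_norm_def by linarith
  qed
  then show "\<exists>no. \<forall>n\<ge>no. norm (expected_SW_PM \<mu> q (q / 2) n - ?L) < e"
    by (simp add: eventually_sequentially)
qed

end

theorem theorem3p8:
  fixes \<mu> :: "real measure" and f :: "real \<Rightarrow> real" and q :: real
  assumes "prob_space \<mu>"
    and "\<mu> = density lborel (\<lambda>x. ennreal (f x * indicator {0..1} x))"
    and "\<forall>x\<in>{0..1}. 0 \<le> f x"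
    and "continuous_on {0..1} f"
    and "\<forall>x\<in>{0..1}. \<forall>y\<in>{0..1}. x \<le> y \<longrightarrow> f y \<le> f x"
    and "0 < q" and "q < 1"
  shows "PM_optimal \<mu> q (q / 2)"
proof -
  interpret prob_space \<mu> by fact
  interpret antimono_density \<mu> "\<lambda>x. f x * indicator {0..1} x"
  proof unfold_locales
    show "sets \<mu> = sets borel"
      unfolding assms(2) by simp
    \<comment> \<open>Continuity on the closed interval gives Borel measurability of the extension
      by 0.\<close>
    show "(\<lambda>x. f x * indicator {0..1} x) \<in> borel_measurable borel"
      using borel_measurable_continuous_on_indicator[OF _ assms(4)] by (simp add: mult.commute)
  qed (use assms in \<open>auto split: split_indicator\<close>)
  let ?y = "quantile (q / 2)"
  have "?y \<in> {0..1}"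
    using assms(6,7) quantile_nonneg quantile_le_1 by auto
  moreover have "Wcost \<mu> q ?y \<le> Wcost \<mu> q y" if "y \<in> {0..1}" for y
    using Wcost_ge[OF that assms(6,7)] Wcost_quantile_half[OF assms(6,7)] by simp
  ultimately show ?thesis
    unfolding PM_optimal_def using expected_SW_PM_tendsto[OF assms(6,7)]
    by (intro exI[of _ "q - Wcost \<mu> q ?y"]) auto
qed

end
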